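(* Let $\varepsilon>0$, $\Delta t>0$, and suppose $A \ge \frac{9}{32}\left(\frac{49}{16}\right)^4\varepsilon^{-2}$. Let $u^0,u^{-1},u^{-2}$ be given starting values, and let $u^{n+1}$, $n\ge 0$, be the numerical solution of the scheme $$\frac{\frac{11}{6} u^{n+1} - 3 u^n + \frac32 u^{n-1} - \frac13 u^{n-2}}{\Delta t}+\varepsilon^2 \Delta_N^2 u^{n+1} + \nabla_N \cdot \Bigl( 3 \frac{\nabla_N u^n}{1+ |\nabla_N u^n|^2} -3 \frac{\nabla_N u^{n-1}}{1+ |\nabla_N u^{n-1}|^2} + \frac{\nabla_N u^{n-2}}{1+ |\nabla_N u^{n-2}|^2} \Bigr) +A \Delta t^2 \Delta_N^2( u^{n+1} - u^n) = 0 .$$ Then, for all $k\ge 0$, $$E_N (u^k) \le E_N (u^0) + \frac{3}{4 \Delta t} \| u^0 - u^{-1} \|_2^2 + \frac{1}{6 \Delta t} \| u^{-1} - u^{-2} \|_2^2 + \frac32 \| \nabla_N (u^0 - u^{-1} ) \|_2^2 + \frac12 \| \nabla_N (u^{-1} - u^{-2}) \|_2^2 .$$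
   Context: Setting: $\Omega=(0,1)^2$ with periodic boundary conditions, $N=2K+1$ with $K$ a positive integer, $h=1/N$, grid points $(x_i,y_j)=(ih,jh)$. All $u^k$ (including the "ghost" starting values $u^{-1},u^{-2}$) are real-valued periodic grid functions on this grid. A periodic grid function has the discrete Fourier expansion $f_{i,j}=\sum_{k,\ell=-K}^{K}\hat f_{k,\ell}\exp(2\pi \mathrm{i}(kx_i+\ell y_j))$. The pseudo-spectral derivatives are $(\mathcal D_{Nx}f)_{i,j}=\sum_{k,\ell=-K}^{K}(2k\pi \mathrm{i})\hat f_{k,\ell}\exp(2\pi \mathrm{i}(kx_i+\ell y_j))$, $(\mathcal D_{Nx}^2f)_{i,j}=\sum_{k,\ell=-K}^{K}(-4\pi^2k^2)\hat f_{k,\ell}\exp(2\pi \mathrm{i}(kx_i+\ell y_j))$, and similarly $\mathcal D_{Ny},\mathcal D_{Ny}^2$ in the $y$ direction (with $\ell$ in place of $k$ in the multiplier). Then $\Delta_N f=(\mathcal D_{Nx}^2+\mathcal D_{Ny}^2)f$, $\nabla_N f=(\mathcal D_{Nx}f,\mathcal D_{Ny}f)^T$, $\nabla_N\cdot(f_1,f_2)^T=\mathcal D_{Nx}f_1+\mathcal D_{Ny}f_2$. Nonlinear expressions such as $\frac{\nabla_N u}{1+|\nabla_N u|^2}$ are evaluated pointwise on the grid, with $|\cdot|$ the Euclidean norm in $\mathbb R^2$. Discrete inner product and norm: $\langle f,g\rangle=h^2\sum_{i,j=0}^{N-1}f_{i,j}g_{i,j}$, $\|f\|_2=\sqrt{\langle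 f,f\rangle}$; for vector grid functions the inner product is summed over components. Discrete energy: $E_N(\phi)=E_{c,1,N}(\phi)+\frac{\varepsilon^2}{2}\|\Delta_N\phi\|_2^2$ with $E_{c,1,N}(\phi)=h^2\sum_{i,j=0}^{N-1}\left(-\frac12\ln\left(1+|\nabla_N\phi|^2\right)_{i,j}\right)$. *)

theory Defs
  imports "HOL-Analysis.Analysis"
begin

text \<open>
  Everything is parametrised by \<open>K\<close>; the grid has \<open>N = 2K + 1\<close> points in each direction.
  A grid function is an array indexed by all pairs of integers; only the values at indices in
  \<open>{0..<N}\<close> enter the definitions below, and \<open>periodic_grid\<close> ties the others to them.
  Vector grid functions take values in \<open>real \<times> real\<close>, whose library norm and inner product
  are the Euclidean ones.
\<close>

type_synonym 'a grid_fun = "int \<Rightarrow> int \<Rightarrow> 'a"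

definition grid_N :: "nat \<Rightarrow> nat" where
  "grid_N K = 2 * K + 1"

definition grid_h :: "nat \<Rightarrow> real" where
  "grid_h K = 1 / real (grid_N K)"

definition grid_pt :: "nat \<Rightarrow> int \<Rightarrow> real" where
  "grid_pt K i = of_int i * grid_h K"

definition periodic_grid :: "nat \<Rightarrow> 'a grid_fun \<Rightarrow> bool" where
  "periodic_grid K f \<longleftrightarrow>
     (\<forall>i j. f (i + int (grid_N K)) j = f i j \<and> f i (j + int (grid_N K)) = f i j)"

definition fourier_mode :: "nat \<Rightarrow> int \<Rightarrow> int \<Rightarrow> int \<Rightarrow> int \<Rightarrow> complex" where
  "fourier_mode K k l i j =
     exp (2 * of_real pi * \<i> * of_real (of_int k * grid_pt K i + of_int l * grid_pt K j))"

text \<open>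
  The coefficients are given by the inversion formula; \<open>fourier_expansion\<close> and
  \<open>fourier_coeff_unique\<close> below show that they are exactly the coefficients of the
  discrete Fourier expansion.
\<close>

definition fourier_coeff :: "nat \<Rightarrow> real grid_fun \<Rightarrow> int \<Rightarrow> int \<Rightarrow> complex" where
  "fourier_coeff K f k l =
     of_real ((grid_h K)\<^sup>2) *
       (\<Sum>i\<in>{0..<int (grid_N K)}. \<Sum>j\<in>{0..<int (grid_N K)}.
          of_real (f i j) * fourier_mode K (- k) (- l) i j)"

text \<open>
  The operator with Fourier multiplier \<open>m\<close>. For the multipliers used below the complex sum
  is real (\<open>DN_real\<close>), so that \<open>Re\<close> only changes the type.
\<close>

definition multiplier_op ::
  "nat \<Rightarrow> (int \<Rightarrow> int \<Rightarrow> complex) \<Rightarrow> real grid_fun \<Rightarrow> real grid_fun" where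
  "multiplier_op K m f i j =
     Re (\<Sum>k\<in>{- int K..int K}. \<Sum>l\<in>{- int K..int K}.
           m k l * fourier_coeff K f k l * fourier_mode K k l i j)"

definition DNx :: "nat \<Rightarrow> real grid_fun \<Rightarrow> real grid_fun" where
  "DNx K = multiplier_op K (\<lambda>k l. 2 * of_int k * of_real pi * \<i>)"

definition DNy :: "nat \<Rightarrow> real grid_fun \<Rightarrow> real grid_fun" where
  "DNy K = multiplier_op K (\<lambda>k l. 2 * of_int l * of_real pi * \<i>)"

definition DNx2 :: "nat \<Rightarrow> real grid_fun \<Rightarrow> real grid_fun" where
  "DNx2 K = multiplier_op K (\<lambda>k l. - 4 * of_real pi ^ 2 * of_int k ^ 2)"

definition DNy2 :: "nat \<Rightarrow> real grid_fun \<Rightarrow> real grid_fun" where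
  "DNy2 K = multiplier_op K (\<lambda>k l. - 4 * of_real pi ^ 2 * of_int l ^ 2)"

definition lap_N :: "nat \<Rightarrow> real grid_fun \<Rightarrow> real grid_fun" where
  "lap_N K f i j = DNx2 K f i j + DNy2 K f i j"

definition grad_N :: "nat \<Rightarrow> real grid_fun \<Rightarrow> (real \<times> real) grid_fun" where
  "grad_N K f i j = (DNx K f i j, DNy K f i j)"

definition div_N :: "nat \<Rightarrow> (real \<times> real) grid_fun \<Rightarrow> real grid_fun" where
  "div_N K F i j = DNx K (\<lambda>i j. fst (F i j)) i j + DNy K (\<lambda>i j. snd (F i j)) i j"

definition slope_flux :: "nat \<Rightarrow> real grid_fun \<Rightarrow> (real \<times> real) grid_fun" where
  "slope_flux K f i j = grad_N K f i j /\<^sub>R (1 + (norm (grad_N K f i j))\<^sup>2)"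

definition grid_inner :: "nat \<Rightarrow> 'a::real_inner grid_fun \<Rightarrow> 'a grid_fun \<Rightarrow> real" where
  "grid_inner K f g =
     (grid_h K)\<^sup>2 * (\<Sum>i\<in>{0..<int (grid_N K)}. \<Sum>j\<in>{0..<int (grid_N K)}. f i j \<bullet> g i j)"

definition grid_norm :: "nat \<Rightarrow> 'a::real_inner grid_fun \<Rightarrow> real" where
  "grid_norm K f = sqrt (grid_inner K f f)"

definition energy_c1_N :: "nat \<Rightarrow> real grid_fun \<Rightarrow> real" where
  "energy_c1_N K f =
     (grid_h K)\<^sup>2 * (\<Sum>i\<in>{0..<int (grid_N K)}. \<Sum>j\<in>{0..<int (grid_N K)}.
        - (1 / 2) * ln (1 + (norm (grad_N K f i j))\<^sup>2))"

definition energy_N :: "nat \<Rightarrow> real \<Rightarrow> real grid_fun \<Rightarrow> real" where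
  "energy_N K \<epsilon> f = energy_c1_N K f + \<epsilon>\<^sup>2 / 2 * (grid_norm K (lap_N K f))\<^sup>2"

text \<open>
  One step of the scheme, as an equation at every grid point; \<open>v\<close> is the new value
  \<open>u\<^sup>n\<^sup>+\<^sup>1\<close>, and \<open>u0\<close>, \<open>u1\<close>, \<open>u2\<close> are \<open>u\<^sup>n\<close>, \<open>u\<^sup>n\<^sup>-\<^sup>1\<close>, \<open>u\<^sup>n\<^sup>-\<^sup>2\<close>.
\<close>

definition bdf3_step ::
  "nat \<Rightarrow> real \<Rightarrow> real \<Rightarrow> real \<Rightarrow> real grid_fun \<Rightarrow> real grid_fun \<Rightarrow> real grid_fun \<Rightarrow>
     real grid_fun \<Rightarrow> bool" where
  "bdf3_step K \<epsilon> \<Delta>t A v u0 u1 u2 \<longleftrightarrow>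
     (\<forall>i\<in>{0..<int (grid_N K)}. \<forall>j\<in>{0..<int (grid_N K)}.
        (11 / 6 * v i j - 3 * u0 i j + 3 / 2 * u1 i j - 1 / 3 * u2 i j) / \<Delta>t
        + \<epsilon>\<^sup>2 * lap_N K (lap_N K v) i j
        + div_N K (\<lambda>i j. 3 *\<^sub>R slope_flux K u0 i j - 3 *\<^sub>R slope_flux K u1 i j
                         + slope_flux K u2 i j) i j
        + A * \<Delta>t\<^sup>2 * lap_N K (lap_N K (\<lambda>i j. v i j - u0 i j)) i j = 0)"


subsection \<open>Consistency of the discrete Fourier transform\<close>

definition omega :: "nat \<Rightarrow> int \<Rightarrow> complex" where
  "omega K n = exp (2 * of_real pi * \<i> * of_real (of_int n * grid_h K))"

lemma omega_add: "omega K (m + n) = omega K m * omega K n"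
  by (simp add: omega_def algebra_simps flip: exp_add)

lemma omega_mult_diff: "omega K (k * (i - j)) = omega K (k * i) * omega K (- (k * j))"
  by (simp add: right_diff_distrib flip: omega_add)

lemma fourier_mode_omega: "fourier_mode K k l i j = omega K (k * i) * omega K (l * j)"
  by (simp add: fourier_mode_def omega_def grid_pt_def algebra_simps flip: exp_add)

lemma omega_eq_1_iff: "omega K n = 1 \<longleftrightarrow> int (grid_N K) dvd n"
proof -
  have "grid_N K > 0" by (simp add: grid_N_def)
  then have "(2 * pi * (of_int n * grid_h K) = of_int (2 * m) * pi) \<longleftrightarrow> n = int (grid_N K) * m" for m
  proof -
    have "(2 * pi * (of_int n * grid_h K) = of_int (2 * m) * pi)
            \<longleftrightarrow> (of_int n :: real) = of_int (int (grid_N K) * m)"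
      using \<open>grid_N K > 0\<close> by (auto simp: grid_h_def field_simps)
    then show ?thesis by (simp only: of_int_eq_iff)
  qed
  then show ?thesis
    by (simp add: omega_def exp_eq_1 dvd_def)
qed

lemma omega_mult_nat: "omega K (int m * n) = omega K n ^ m"
  by (induction m) (simp_all add: omega_add distrib_right, simp add: omega_def)

lemma omega_orthogonality:
  "(\<Sum>m\<in>{a..<a + int (grid_N K)}. omega K (m * d))
     = (if int (grid_N K) dvd d then of_nat (grid_N K) else 0)"
proof -
  let ?N = "grid_N K"
  have "(\<Sum>m\<in>{a..<a + int ?N}. omega K (m * d)) = (\<Sum>m<?N. omega K ((a + int m) * d))"
    by (rule sum.reindex_bij_witness[of _ "\<lambda>m. a + int m" "\<lambda>m. nat (m - a)"]) auto
  also have "\<dots> = omega K (a * d) * (\<Sum>m<?N. omega K d ^ m)"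
    by (simp add: distrib_right omega_add omega_mult_nat sum_distrib_left)
  also have "\<dots> = (if int ?N dvd d then of_nat ?N else 0)"
  proof (cases "int ?N dvd d")
    case True
    then have "omega K d = 1" "omega K (a * d) = 1" by (simp_all add: omega_eq_1_iff)
    then show ?thesis using True by simp
  next
    case False
    then have "omega K d \<noteq> 1" by (simp add: omega_eq_1_iff)
    moreover have "omega K d ^ ?N = 1"
      by (simp add: omega_eq_1_iff flip: omega_mult_nat)
    ultimately show ?thesis using False by (simp add: geometric_sum)
  qed
  finally show ?thesis .
qed

lemma omega_orthogonality_sym:
  "(\<Sum>m\<in>{- int K..int K}. omega K (m * d))
     = (if int (grid_N K) dvd d then of_nat (grid_N K) else 0)"
proof -
  have "{- int K..int K} = {- int K..<- int K + int (grid_N K)}"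
    by (auto simp: grid_N_def)
  then show ?thesis by (simp only: omega_orthogonality)
qed

lemma dvd_small_diff:
  fixes N i j a :: int
  assumes "i \<in> {a..<a + N}" "j \<in> {a..<a + N}"
  shows "N dvd i - j \<longleftrightarrow> i = j"
proof
  assume "N dvd i - j"
  moreover have "\<bar>i - j\<bar> < \<bar>N\<bar>" using assms by auto
  ultimately show "i = j" using dvd_imp_le_int[of "i - j" N] by auto
qed simp

lemma periodic_gridD:
  assumes "periodic_grid K f"
  shows "f (i mod int (grid_N K)) (j mod int (grid_N K)) = f i j"
proof -
  let ?N = "int (grid_N K)"
  have P: "f (i + ?N) j = f i j" "f i (j + ?N) = f i j" for i j
    using assms by (auto simp: periodic_grid_def)
  have 1: "f (i + ?N * q) j = f i j" for i j q
  proof (induction q)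
    case (nonneg n) then show ?case
      by (induction n) (auto simp: algebra_simps P(1) simp flip: add.assoc P(1)[of "i + _" j])
  next
    case (neg n)
    show ?case
    proof (induction n)
      case 0 show ?case using P(1)[of "i - ?N" j] by simp
    next
      case (Suc n)
      then show ?case using P(1)[of "i + ?N * (- int (Suc (Suc n)))" j]
        by (simp add: algebra_simps)
    qed
  qed
  have 2: "f i (j + ?N * q) = f i j" for i j q
  proof (induction q)
    case (nonneg n) then show ?case
      by (induction n) (auto simp: algebra_simps P(2) simp flip: add.assoc P(2)[of i "j + _"])
  next
    case (neg n)
    show ?case
    proof (induction n)
      case 0 show ?case using P(2)[of i "j - ?N"] by simp
    next
      case (Suc n)
      then show ?case using P(2)[of i "j + ?N * (- int (Suc (Suc n)))"]
        by (simp add: algebra_simps)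
    qed
  qed
  have "f (i mod ?N) (j mod ?N) = f (i mod ?N + ?N * (i div ?N)) (j mod ?N + ?N * (j div ?N))"
    by (simp only: 1 2)
  then show ?thesis by simp
qed

lemma fourier_mode_mod:
  "fourier_mode K k l (i mod int (grid_N K)) (j mod int (grid_N K)) = fourier_mode K k l i j"
proof -
  have "omega K (k * (i mod int (grid_N K))) = omega K (k * i)" for k i
  proof -
    have "omega K (k * i) = omega K (k * (i mod int (grid_N K)) + int (grid_N K) * (k * (i div int (grid_N K))))"
      by (metis distrib_left mod_mult_div_eq mult.left_commute)
    also have "\<dots> = omega K (k * (i mod int (grid_N K)))"
      using omega_eq_1_iff[of K "int (grid_N K) * _"] by (simp add: omega_add)
    finally show ?thesis by simp
  qed
  then show ?thesis by (simp add: fourier_mode_omega)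
qed

lemma double_sum_swap:
  fixes g :: "int \<Rightarrow> int \<Rightarrow> int \<Rightarrow> int \<Rightarrow> complex"
  shows "(\<Sum>k\<in>S. \<Sum>l\<in>S. \<Sum>i\<in>T. \<Sum>j\<in>T. g k l i j) = (\<Sum>i\<in>T. \<Sum>j\<in>T. \<Sum>k\<in>S. \<Sum>l\<in>S. g k l i j)"
proof -
  have pair: "(\<Sum>k\<in>A. \<Sum>l\<in>A. h k l) = (\<Sum>x\<in>A \<times> A. h (fst x) (snd x))"
    for A :: "int set" and h :: "int \<Rightarrow> int \<Rightarrow> complex"
    by (simp add: sum.cartesian_product case_prod_beta)
  show ?thesis unfolding pair by (rule sum.swap)
qed

lemma sum_sum_delta:
  fixes g :: "int \<Rightarrow> int \<Rightarrow> complex"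
  assumes "finite S" "i \<in> S" "j \<in> S"
  shows "(\<Sum>i'\<in>S. \<Sum>j'\<in>S. g i' j' * ((if i' = i then c else 0) * (if j' = j then c else 0)))
           = g i j * c\<^sup>2"
proof -
  have "(\<Sum>i'\<in>S. \<Sum>j'\<in>S. g i' j' * ((if i' = i then c else 0) * (if j' = j then c else 0)))
      = (\<Sum>i'\<in>S. if i' = i then g i' j * c\<^sup>2 else 0)"
  proof (rule sum.cong[OF refl])
    fix i' assume "i' \<in> S"
    have "(\<Sum>j'\<in>S. g i' j' * ((if i' = i then c else 0) * (if j' = j then c else 0)))
        = (\<Sum>j'\<in>S. if j' = j then (if i' = i then g i' j' * c\<^sup>2 else 0) else 0)"
      by (rule sum.cong) (auto simp: power2_eq_square)
    then show "(\<Sum>j'\<in>S. g i' j' * ((if i' = i then c else 0) * (if j' = j then c else 0)))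
        = (if i' = i then g i' j * c\<^sup>2 else 0)"
      using assms by simp
  qed
  then show ?thesis using assms by simp
qed

lemma grid_h_N: "of_real ((grid_h K)\<^sup>2) * (of_nat (grid_N K))\<^sup>2 = (1 :: complex)"
  by (simp add: grid_h_def grid_N_def power_divide flip: of_nat_Suc of_nat_power)

theorem fourier_expansion:
  assumes "periodic_grid K f"
  shows "of_real (f i j) = (\<Sum>k\<in>{- int K..int K}. \<Sum>l\<in>{- int K..int K}.
           fourier_coeff K f k l * fourier_mode K k l i j)"
proof -
  let ?N = "int (grid_N K)"
  let ?S = "{- int K..int K}" and ?T = "{0..<int (grid_N K)}"
  have main: "(\<Sum>k\<in>?S. \<Sum>l\<in>?S. fourier_coeff K f k l * fourier_mode K k l i j) = of_real (f i j)"
    if ij: "i \<in> ?T" "j \<in> ?T" for i j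
  proof -
    let ?h = "of_real ((grid_h K)\<^sup>2) :: complex"
    let ?c = "of_nat (grid_N K) :: complex"
    have ker: "(\<Sum>k\<in>?S. omega K (k * (i - i'))) = (if i' = i then ?c else 0)"
      if "i \<in> ?T" "i' \<in> ?T" for i i'
      using dvd_small_diff[of i 0 ?N i'] that by (auto simp: omega_orthogonality_sym)
    have "(\<Sum>k\<in>?S. \<Sum>l\<in>?S. fourier_coeff K f k l * fourier_mode K k l i j)
        = (\<Sum>k\<in>?S. \<Sum>l\<in>?S. \<Sum>i'\<in>?T. \<Sum>j'\<in>?T.
             ?h * of_real (f i' j') * (omega K (k * (i - i')) * omega K (l * (j - j'))))"
      unfolding fourier_coeff_def fourier_mode_omega sum_distrib_left sum_distrib_right
      by (intro sum.cong refl)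
        (simp add: omega_mult_diff mult_ac)
    also have "\<dots> = (\<Sum>i'\<in>?T. \<Sum>j'\<in>?T. \<Sum>k\<in>?S. \<Sum>l\<in>?S.
             ?h * of_real (f i' j') * (omega K (k * (i - i')) * omega K (l * (j - j'))))"
      by (rule double_sum_swap)
    also have "\<dots> = (\<Sum>i'\<in>?T. \<Sum>j'\<in>?T. ?h * of_real (f i' j') *
             ((if i' = i then ?c else 0) * (if j' = j then ?c else 0)))"
    proof (intro sum.cong refl)
      fix i' j' assume *: "i' \<in> ?T" "j' \<in> ?T"
      show "(\<Sum>k\<in>?S. \<Sum>l\<in>?S.
             ?h * of_real (f i' j') * (omega K (k * (i - i')) * omega K (l * (j - j'))))
         = ?h * of_real (f i' j') * ((if i' = i then ?c else 0) * (if j' = j then ?c else 0))"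
        unfolding ker[OF ij(1) *(1), symmetric] ker[OF ij(2) *(2), symmetric] sum_product
        by (simp only: sum_distrib_left)
    qed
    also have "\<dots> = ?h * of_real (f i j) * ?c\<^sup>2"
      using ij by (intro sum_sum_delta) auto
    also have "\<dots> = of_real (f i j)"
      using grid_h_N[of K] by (metis mult.commute mult.left_commute mult.right_neutral)
    finally show ?thesis .
  qed
  have "?N > 0" by (simp add: grid_N_def)
  then show ?thesis
    using main[of "i mod ?N" "j mod ?N"]
    by (simp add: fourier_mode_mod periodic_gridD[OF assms])
qed

theorem fourier_coeff_unique:
  assumes f: "\<And>i j. i \<in> {0..<int (grid_N K)} \<Longrightarrow> j \<in> {0..<int (grid_N K)} \<Longrightarrow>
      of_real (f i j) = (\<Sum>k\<in>{- int K..int K}. \<Sum>l\<in>{- int K..int K}.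
             c k l * fourier_mode K k l i j)"
    and kl: "k \<in> {- int K..int K}" "l \<in> {- int K..int K}"
  shows "c k l = fourier_coeff K f k l"
proof -
  let ?N = "int (grid_N K)"
  let ?S = "{- int K..int K}" and ?T = "{0..<int (grid_N K)}"
  let ?h = "of_real ((grid_h K)\<^sup>2) :: complex"
  let ?c = "of_nat (grid_N K) :: complex"
  have S: "?S = {- int K..<- int K + ?N}"
    by (auto simp: grid_N_def)
  have ker: "(\<Sum>i\<in>?T. omega K (i * (k' - k))) = (if k' = k then ?c else 0)"
    if "k \<in> ?S" "k' \<in> ?S" for k k'
    using omega_orthogonality[where a = 0 and K = K and d = "k' - k"]
      dvd_small_diff[OF that(2)[unfolded S] that(1)[unfolded S]]
    by (simp only: add_0)
  have "fourier_coeff K f k l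
      = (\<Sum>i\<in>?T. \<Sum>j\<in>?T. \<Sum>k'\<in>?S. \<Sum>l'\<in>?S.
           ?h * c k' l' * (omega K (i * (k' - k)) * omega K (j * (l' - l))))"
    unfolding fourier_coeff_def sum_distrib_left
  proof (intro sum.cong refl)
    fix i j assume ij: "i \<in> ?T" "j \<in> ?T"
    show "?h * (of_real (f i j) * fourier_mode K (- k) (- l) i j)
        = (\<Sum>k'\<in>?S. \<Sum>l'\<in>?S.
           ?h * c k' l' * (omega K (i * (k' - k)) * omega K (j * (l' - l))))"
      unfolding f[OF ij] sum_distrib_left sum_distrib_right fourier_mode_omega
      by (intro sum.cong refl)
        (simp add: omega_mult_diff mult_ac)
  qed
  also have "\<dots> = (\<Sum>k'\<in>?S. \<Sum>l'\<in>?S. \<Sum>i\<in>?T. \<Sum>j\<in>?T.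
           ?h * c k' l' * (omega K (i * (k' - k)) * omega K (j * (l' - l))))"
    by (rule double_sum_swap)
  also have "\<dots> = (\<Sum>k'\<in>?S. \<Sum>l'\<in>?S. ?h * c k' l' *
           ((if k' = k then ?c else 0) * (if l' = l then ?c else 0)))"
  proof (intro sum.cong refl)
    fix k' l' assume *: "k' \<in> ?S" "l' \<in> ?S"
    show "(\<Sum>i\<in>?T. \<Sum>j\<in>?T.
           ?h * c k' l' * (omega K (i * (k' - k)) * omega K (j * (l' - l))))
       = ?h * c k' l' * ((if k' = k then ?c else 0) * (if l' = l then ?c else 0))"
      unfolding ker[OF kl(1) *(1), symmetric] ker[OF kl(2) *(2), symmetric] sum_product
      by (simp only: sum_distrib_left)
  qed
  also have "\<dots> = ?h * c k l * ?c\<^sup>2"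
    using kl by (intro sum_sum_delta) auto
  also have "\<dots> = c k l"
    using grid_h_N[of K] by (metis mult.commute mult.left_commute mult.right_neutral)
  finally show ?thesis by simp
qed

lemma cnj_fourier_mode: "cnj (fourier_mode K k l i j) = fourier_mode K (- k) (- l) i j"
  by (simp add: fourier_mode_def exp_cnj algebra_simps)

lemma cnj_fourier_coeff: "cnj (fourier_coeff K f k l) = fourier_coeff K f (- k) (- l)"
  by (simp add: fourier_coeff_def cnj_fourier_mode cnj_sum)

lemma multiplier_op_real:
  assumes "\<And>k l. cnj (m k l) = m (- k) (- l)"
  shows "of_real (multiplier_op K m f i j) =
     (\<Sum>k\<in>{- int K..int K}. \<Sum>l\<in>{- int K..int K}.
        m k l * fourier_coeff K f k l * fourier_mode K k l i j)" (is "_ = ?s")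
proof -
  let ?S = "{- int K..int K}"
  have "cnj ?s = (\<Sum>k\<in>?S. \<Sum>l\<in>?S.
        m (- k) (- l) * fourier_coeff K f (- k) (- l) * fourier_mode K (- k) (- l) i j)"
    by (simp add: cnj_sum assms cnj_fourier_coeff cnj_fourier_mode)
  also have "\<dots> = (\<Sum>k\<in>?S. \<Sum>l\<in>?S.
        m k (- l) * fourier_coeff K f k (- l) * fourier_mode K k (- l) i j)"
    by (rule sum.reindex_bij_witness[of _ uminus uminus]) auto
  also have "\<dots> = ?s"
  proof (rule sum.cong[OF refl])
    fix k
    show "(\<Sum>l\<in>?S. m k (- l) * fourier_coeff K f k (- l) * fourier_mode K k (- l) i j)
        = (\<Sum>l\<in>?S. m k l * fourier_coeff K f k l * fourier_mode K k l i j)"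
      by (rule sum.reindex_bij_witness[of _ uminus uminus]) auto
  qed
  finally have "?s \<in> \<real>" by (simp add: Reals_cnj_iff)
  then show ?thesis by (simp only: multiplier_op_def of_real_Re)
qed

theorem DN_real:
  shows "of_real (DNx K f i j) = (\<Sum>k\<in>{- int K..int K}. \<Sum>l\<in>{- int K..int K}.
           2 * of_int k * of_real pi * \<i> * fourier_coeff K f k l * fourier_mode K k l i j)"
    and "of_real (DNy K f i j) = (\<Sum>k\<in>{- int K..int K}. \<Sum>l\<in>{- int K..int K}.
           2 * of_int l * of_real pi * \<i> * fourier_coeff K f k l * fourier_mode K k l i j)"
    and "of_real (DNx2 K f i j) = (\<Sum>k\<in>{- int K..int K}. \<Sum>l\<in>{- int K..int K}.
           - 4 * of_real pi ^ 2 * of_int k ^ 2 * fourier_coeff K f k l * fourier_mode K k l i j)"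
    and "of_real (DNy2 K f i j) = (\<Sum>k\<in>{- int K..int K}. \<Sum>l\<in>{- int K..int K}.
           - 4 * of_real pi ^ 2 * of_int l ^ 2 * fourier_coeff K f k l * fourier_mode K k l i j)"
  unfolding DNx_def DNy_def DNx2_def DNy2_def by (rule multiplier_op_real; simp)+

end

theory Submission
  imports Defs
begin

text \<open>
  Test the scheme with \<open>d = u\<^sup>n\<^sup>+\<^sup>1 - u\<^sup>n\<close> and sum by parts. The function
  \<open>1/2 ln (1 + |p|\<^sup>2) + 1/16 |p|\<^sup>2\<close> is convex and the flux \<open>p / (1 + |p|\<^sup>2)\<close> is 1-Lipschitz,
  so the nonlinear terms cost at most \<open>49/16 |grad d|\<^sup>2\<close> beyond the telescoping terms of a
  modified energy. Since \<open>\<parallel>grad d\<parallel>\<^sup>2 = - \<langle>d, lap d\<rangle>\<close>, the condition on \<open>A\<close> is exactly what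
  lets the left-over \<open>1/(3\<Delta>t) d\<^sup>2 + (\<epsilon>\<^sup>2/2 + A\<Delta>t\<^sup>2) (lap d)\<^sup>2\<close> absorb this cost. So the modified
  energy decreases, and it dominates the energy.
\<close>

section \<open>Averages over the grid\<close>

text \<open>As \<open>h^2 N^2 = 1\<close>, this is the average over the grid. Inner products,
  squared norms and energies are all averages of densities, so inequalities can be proved point by
  point and then averaged.\<close>

definition grid_mean :: "nat \<Rightarrow> real grid_fun \<Rightarrow> real" where
  "grid_mean K f =
     (grid_h K)\<^sup>2 * (\<Sum>i\<in>{0..<int (grid_N K)}. \<Sum>j\<in>{0..<int (grid_N K)}. f i j)"

lemma grid_inner_eq_mean: "grid_inner K f g = grid_mean K (\<lambda>i j. f i j \<bullet> g i j)"
  by (simp add: grid_inner_def grid_mean_def)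

lemma grid_mean_add: "grid_mean K (\<lambda>i j. f i j + g i j) = grid_mean K f + grid_mean K g"
  by (simp add: grid_mean_def sum.distrib distrib_left)

lemma grid_mean_diff: "grid_mean K (\<lambda>i j. f i j - g i j) = grid_mean K f - grid_mean K g"
  by (simp add: grid_mean_def sum_subtractf right_diff_distrib)

lemma grid_mean_cmult: "grid_mean K (\<lambda>i j. c * f i j) = c * grid_mean K f"
  by (simp add: grid_mean_def mult.left_commute flip: sum_distrib_left)

lemma grid_mean_mono:
  assumes "\<And>i j. i \<in> {0..<int (grid_N K)} \<Longrightarrow> j \<in> {0..<int (grid_N K)} \<Longrightarrow> f i j \<le> g i j"
  shows "grid_mean K f \<le> grid_mean K g"
  unfolding grid_mean_def by (intro mult_left_mono sum_mono assms) auto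

lemma grid_norm_sq: "(grid_norm K f)\<^sup>2 = grid_mean K (\<lambda>i j. (norm (f i j))\<^sup>2)"
proof -
  have "0 \<le> grid_inner K f f"
    unfolding grid_inner_def by (intro mult_nonneg_nonneg sum_nonneg) auto
  then show ?thesis
    by (simp add: grid_norm_def grid_inner_eq_mean power2_norm_eq_inner)
qed

section \<open>Fourier multipliers and summation by parts\<close>

lemma fourier_coeff_diff:
  "fourier_coeff K (\<lambda>i j. f i j - g i j) k l = fourier_coeff K f k l - fourier_coeff K g k l"
  by (simp add: fourier_coeff_def left_diff_distrib right_diff_distrib sum_subtractf)

lemma multiplier_op_diff:
  "multiplier_op K m (\<lambda>i j. f i j - g i j) i j = multiplier_op K m f i j - multiplier_op K m g i j"
  by (simp only: multiplier_op_def fourier_coeff_diff left_diff_distrib right_diff_distrib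
      sum_subtractf minus_complex.simps)

text \<open>The symmetry of \<open>m\<close> makes the sum behind \<open>multiplier_op\<close> real,
  so that sum is a Fourier expansion of the result, and uniqueness reads off its
  coefficients.\<close>

lemma fourier_coeff_multiplier_op:
  assumes "\<And>k l. cnj (m k l) = m (- k) (- l)"
    and "k \<in> {- int K..int K}" "l \<in> {- int K..int K}"
  shows "fourier_coeff K (multiplier_op K m f) k l = m k l * fourier_coeff K f k l"
  using fourier_coeff_unique[of K "multiplier_op K m f" "\<lambda>k l. m k l * fourier_coeff K f k l" k l]
    multiplier_op_real[of m K f] assms by simp

lemma multiplier_op_comp:
  assumes "\<And>k l. cnj (m' k l) = m' (- k) (- l)"
  shows "multiplier_op K m (multiplier_op K m' f) = multiplier_op K (\<lambda>k l. m k l * m' k l) f"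
  unfolding multiplier_op_def[of K m] multiplier_op_def[of K "\<lambda>k l. m k l * m' k l"]
  by (intro ext arg_cong[where f = Re] sum.cong refl)
    (simp add: fourier_coeff_multiplier_op assms)

text \<open>Parseval's identity with a multiplier: \<open>g\<close> is real and so passes through
  \<open>Re\<close>, and exchanging the sums over grid points and modes collects the coefficients of
  \<open>g\<close>.\<close>

lemma grid_inner_multiplier_op:
  "grid_inner K (multiplier_op K m f) g =
     Re (\<Sum>k\<in>{- int K..int K}. \<Sum>l\<in>{- int K..int K}.
          m k l * fourier_coeff K f k l * cnj (fourier_coeff K g k l))"
proof -
  let ?S = "{- int K..int K}" and ?T = "{0..<int (grid_N K)}"
  let ?h = "of_real ((grid_h K)\<^sup>2) :: complex"
  let ?a = "\<lambda>k l. m k l * fourier_coeff K f k l"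
  have Re_mult_of_real: "Re (of_real x * z) = x * Re z" "Re (z * of_real x) = Re z * x" for z x
    by simp_all
  have "grid_inner K (multiplier_op K m f) g =
      Re (?h * (\<Sum>i\<in>?T. \<Sum>j\<in>?T.
        (\<Sum>k\<in>?S. \<Sum>l\<in>?S. ?a k l * fourier_mode K k l i j) * of_real (g i j)))"
    by (simp only: grid_inner_def multiplier_op_def inner_real_def Re_mult_of_real Re_sum)
  also have "?h * (\<Sum>i\<in>?T. \<Sum>j\<in>?T.
        (\<Sum>k\<in>?S. \<Sum>l\<in>?S. ?a k l * fourier_mode K k l i j) * of_real (g i j))
     = (\<Sum>i\<in>?T. \<Sum>j\<in>?T. \<Sum>k\<in>?S. \<Sum>l\<in>?S.
          ?a k l * (?h * (of_real (g i j) * fourier_mode K k l i j)))"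
    unfolding sum_distrib_left sum_distrib_right by (intro sum.cong refl) (simp add: mult_ac)
  also have "\<dots> = (\<Sum>k\<in>?S. \<Sum>l\<in>?S. \<Sum>i\<in>?T. \<Sum>j\<in>?T.
          ?a k l * (?h * (of_real (g i j) * fourier_mode K k l i j)))"
    by (rule double_sum_swap[symmetric])
  also have "\<dots> = (\<Sum>k\<in>?S. \<Sum>l\<in>?S. ?a k l * cnj (fourier_coeff K g k l))"
    \<comment> \<open>The conjugate coefficient is the one at \<open>(- k, - l)\<close>, whose
      defining sum contains the mode \<open>(k, l)\<close>.\<close>
    unfolding cnj_fourier_coeff
    by (simp add: fourier_coeff_def sum_distrib_left)
  finally show ?thesis .
qed

text \<open>By Parseval the two sides are real parts of conjugate numbers.\<close>

lemma multiplier_op_adjoint: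
  "grid_inner K (multiplier_op K m f) g = grid_inner K f (multiplier_op K (\<lambda>k l. cnj (m k l)) g)"
proof -
  let ?S = "{- int K..int K}"
  have "grid_inner K f (multiplier_op K (\<lambda>k l. cnj (m k l)) g)
      = grid_inner K (multiplier_op K (\<lambda>k l. cnj (m k l)) g) f"
    by (simp add: grid_inner_def mult.commute)
  also have "\<dots> = Re (cnj (\<Sum>k\<in>?S. \<Sum>l\<in>?S.
          m k l * fourier_coeff K f k l * cnj (fourier_coeff K g k l)))"
    unfolding grid_inner_multiplier_op
    by (intro arg_cong[where f = Re]) (simp add: cnj_sum mult_ac)
  finally show ?thesis
    by (simp only: grid_inner_multiplier_op cnj.simps(1))
qed

lemma multiplier_op_uminus: "multiplier_op K (\<lambda>k l. - m k l) f i j = - multiplier_op K m f i j"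
  by (simp add: multiplier_op_def sum_negf)

text \<open>Purely imaginary multipliers change sign under conjugation.\<close>

lemma DN_adjoint:
  "grid_inner K (DNx K f) g = - grid_inner K f (DNx K g)"
  "grid_inner K (DNy K f) g = - grid_inner K f (DNy K g)"
  unfolding DNx_def DNy_def
  by (subst multiplier_op_adjoint, simp add: multiplier_op_uminus grid_inner_def sum_negf)+

lemma DN2_adjoint:
  "grid_inner K (DNx2 K f) g = grid_inner K f (DNx2 K g)"
  "grid_inner K (DNy2 K f) g = grid_inner K f (DNy2 K g)"
  unfolding DNx2_def DNy2_def by (subst multiplier_op_adjoint, simp)+

lemma DN_DN:
  "DNx K (DNx K f) = DNx2 K f"
  "DNy K (DNy K f) = DNy2 K f"
proof -
  have sq: "2 * x * of_real pi * \<i> * (2 * x * of_real pi * \<i>) = - 4 * of_real pi ^ 2 * x ^ 2"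
    for x :: complex
  proof -
    have "2 * x * of_real pi * \<i> * (2 * x * of_real pi * \<i>)
        = \<i> * \<i> * (2 * 2 * (of_real pi * of_real pi) * (x * x))"
      by (simp only: mult_ac)
    then show ?thesis by (simp add: power2_eq_square)
  qed
  show "DNx K (DNx K f) = DNx2 K f" "DNy K (DNy K f) = DNy2 K f"
    unfolding DNx_def DNy_def DNx2_def DNy2_def sq[symmetric]
    by (rule multiplier_op_comp; simp)+
qed

lemma lap_N_adjoint: "grid_inner K (lap_N K f) g = grid_inner K f (lap_N K g)"
  using DN2_adjoint[of K f g]
  by (simp add: grid_inner_eq_mean lap_N_def distrib_left distrib_right grid_mean_add)

lemma div_N_adjoint: "grid_inner K (div_N K F) g = - grid_inner K F (grad_N K g)"
  using DN_adjoint(1)[of K "\<lambda>i j. fst (F i j)" g] DN_adjoint(2)[of K "\<lambda>i j. snd (F i j)" g]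
  by (simp add: grid_inner_eq_mean div_N_def grad_N_def inner_prod_def distrib_right grid_mean_add)

lemma div_N_grad_N: "div_N K (grad_N K f) = lap_N K f"
  by (intro ext) (simp add: div_N_def grad_N_def lap_N_def DN_DN)

lemma grid_norm_grad_N: "(grid_norm K (grad_N K f))\<^sup>2 = - grid_inner K f (lap_N K f)"
proof -
  have "grid_inner K (lap_N K f) f = - grid_inner K (grad_N K f) (grad_N K f)"
    by (simp add: div_N_adjoint flip: div_N_grad_N)
  then show ?thesis
    by (simp add: grid_norm_sq grid_inner_eq_mean power2_norm_eq_inner mult.commute)
qed

lemma grad_N_diff: "grad_N K (\<lambda>i j. f i j - g i j) i j = grad_N K f i j - grad_N K g i j"
  by (simp add: grad_N_def DNx_def DNy_def multiplier_op_diff)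

lemma lap_N_diff: "lap_N K (\<lambda>i j. f i j - g i j) i j = lap_N K f i j - lap_N K g i j"
  by (simp add: lap_N_def DNx2_def DNy2_def multiplier_op_diff)

section \<open>Pointwise inequalities for the flux and the logarithm\<close>

definition flux :: "'a::real_inner \<Rightarrow> 'a" where
  "flux p = p /\<^sub>R (1 + (norm p)\<^sup>2)"

lemma power2_norm_diff: "(norm (x - y))\<^sup>2 = (norm x)\<^sup>2 + (norm y)\<^sup>2 - 2 * (x \<bullet> y)"
  by (simp add: power2_norm_eq_inner inner_diff_left inner_diff_right inner_commute)

text \<open>With \<open>a\<close>, \<open>b\<close> the two scaling factors, the squared right side
  exceeds the squared left side by \<open>(1 - a * b) |p - q|^2 + (a - b)^2\<close>, and
  \<open>a * b \<le> 1\<close>. The second square arises from \<open>a * P = 1 - a\<close> and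
  \<open>b * Q = 1 - b\<close>.\<close>

lemma flux_lipschitz: "norm (flux p - flux q) \<le> norm (p - q)"
proof -
  define P where "P = (norm p)\<^sup>2"
  define Q where "Q = (norm q)\<^sup>2"
  define a where "a = inverse (1 + P)"
  define b where "b = inverse (1 + Q)"
  have PQ: "P \<ge> 0" "Q \<ge> 0" by (simp_all add: P_def Q_def)
  then have a: "a * (1 + P) = 1" "0 < a" "a \<le> 1" and b: "b * (1 + Q) = 1" "0 < b" "b \<le> 1"
    by (auto simp: a_def b_def field_simps)
  have "a * b \<le> 1" using a b by (simp add: mult_le_one)
  moreover have "2 * (p \<bullet> q) \<le> P + Q"
    using zero_le_power2[of "norm (p - q)"]
    by (simp add: power2_norm_diff P_def Q_def)
  ultimately have "(1 - a * b) * (2 * (p \<bullet> q)) \<le> (1 - a * b) * (P + Q)"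
    by (intro mult_left_mono) auto
  moreover have "(P + Q) * (a * b) - (a\<^sup>2 * P + b\<^sup>2 * Q) \<ge> 0"
  proof -
    have eq: "P = inverse a - 1" "Q = inverse b - 1" by (simp_all add: a_def b_def)
    have "(P + Q) * (a * b) - (a\<^sup>2 * P + b\<^sup>2 * Q) = (a - b)\<^sup>2"
      unfolding eq using a(2) b(2) by (simp add: field_simps power2_eq_square)
    then show ?thesis by simp
  qed
  ultimately have "a\<^sup>2 * P + b\<^sup>2 * Q - 2 * (a * b) * (p \<bullet> q) \<le> P + Q - 2 * (p \<bullet> q)"
    by (simp add: algebra_simps)
  moreover have "(norm (flux p - flux q))\<^sup>2 = a\<^sup>2 * P + b\<^sup>2 * Q - 2 * (a * b) * (p \<bullet> q)"
    unfolding flux_def P_def[symmetric] Q_def[symmetric] a_def[symmetric] b_def[symmetric]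
    by (simp add: P_def Q_def power2_norm_diff power_mult_distrib mult.assoc)
  moreover have "(norm (p - q))\<^sup>2 = P + Q - 2 * (p \<bullet> q)"
    by (simp add: P_def Q_def power2_norm_diff)
  ultimately have "(norm (flux p - flux q))\<^sup>2 \<le> (norm (p - q))\<^sup>2" by (simp only:)
  then show ?thesis by (rule power2_le_imp_le) simp
qed

text \<open>The slope \<open>(1 - s^2) / (1 + s^2)^2\<close> of the scalar flux has minimum
  \<open>- 1 / 8\<close>, at \<open>s^2 = 3\<close>, so adding \<open>s / 8\<close> makes it
  monotone. The factorisation into squares shows this without derivatives.\<close>

lemma flux_real_monotone:
  fixes r s :: real
  shows "0 \<le> (s / (1 + s\<^sup>2) - r / (1 + r\<^sup>2) + (s - r) / 8) * (s - r)"
proof -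
  have pos: "1 + s\<^sup>2 > 0" "1 + r\<^sup>2 > 0" by (simp_all add: add_pos_nonneg)
  have "(s / (1 + s\<^sup>2) - r / (1 + r\<^sup>2) + (s - r) / 8) * (s - r)
      = ((r * s - 3)\<^sup>2 + (r - s)\<^sup>2) * (s - r)\<^sup>2 / (8 * (1 + s\<^sup>2) * (1 + r\<^sup>2))"
    using pos[THEN less_imp_neq] by (simp add: divide_simps) (simp add: power2_eq_square algebra_simps)
  then show ?thesis using pos by simp
qed

lemma ln_1_plus_sq_above_tangent_real:
  fixes r s :: real
  shows "1 / 2 * ln (1 + s\<^sup>2) - 1 / 2 * ln (1 + r\<^sup>2) - r / (1 + r\<^sup>2) * (s - r) + 1 / 16 * (s - r)\<^sup>2 \<ge> 0"
proof -
  define c where "c = r / (1 + r\<^sup>2)"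
  \<comment> \<open>The claim says that \<open>\<phi>\<close> is minimal at \<open>r\<close>. Its
    derivative \<open>\<phi>'\<close> has the sign of \<open>s - r\<close> by
    \<open>flux_real_monotone\<close>.\<close>
  define \<phi> where "\<phi> s = 1 / 2 * ln (1 + s\<^sup>2) - c * (s - r) + 1 / 16 * (s - r)\<^sup>2" for s
  define \<phi>' where "\<phi>' s = s / (1 + s\<^sup>2) - c + (s - r) / 8" for s
  have deriv: "(\<phi> has_real_derivative \<phi>' x) (at x)" for x
  proof -
    have "1 + x\<^sup>2 > 0" by (simp add: add_pos_nonneg)
    then show ?thesis unfolding \<phi>_def \<phi>'_def
      by (auto intro!: derivative_eq_intros simp: field_simps)
  qed
  have "\<phi> r \<le> \<phi> s"
  proof (cases r s rule: linorder_cases)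
    case less
    then obtain z where "r < z" "z < s" "\<phi> s - \<phi> r = (s - r) * \<phi>' z"
      using MVT2[of r s \<phi> \<phi>'] deriv by blast
    moreover from this have "\<phi>' z \<ge> 0"
      using flux_real_monotone[of z r] by (simp add: \<phi>'_def c_def zero_le_mult_iff)
    ultimately show ?thesis using less by (smt (verit) mult_nonneg_nonneg)
  next
    case greater
    then obtain z where "s < z" "z < r" "\<phi> r - \<phi> s = (r - s) * \<phi>' z"
      using MVT2[of s r \<phi> \<phi>'] deriv by blast
    moreover from this have "\<phi>' z \<le> 0"
      using flux_real_monotone[of z r] by (simp add: \<phi>'_def c_def zero_le_mult_iff)
    ultimately show ?thesis using greater by (smt (verit) mult_nonneg_nonpos)
  qed simp
  then show ?thesis by (simp add: \<phi>_def c_def)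
qed

text \<open>
  The inner product \<open>p \<bullet> q\<close> enters with a negative coefficient, so Cauchy-Schwarz
  reduces the claim to collinear vectors.
\<close>

lemma ln_1_plus_norm_sq_above_tangent:
  fixes p q :: "'a::real_inner"
  shows "- (1 / 2) * ln (1 + (norm q)\<^sup>2) - (- (1 / 2) * ln (1 + (norm p)\<^sup>2))
    \<le> - (flux p \<bullet> (q - p)) + 1 / 16 * (norm (q - p))\<^sup>2"
proof -
  let ?r = "norm p" and ?s = "norm q"
  define a where "a = inverse (1 + ?r\<^sup>2)"
  have "a > 0" by (simp add: a_def add_pos_nonneg)
  moreover have "p \<bullet> q \<le> ?r * ?s" by (rule norm_cauchy_schwarz)
  ultimately have "(a + 1 / 8) * (p \<bullet> q) \<le> (a + 1 / 8) * (?r * ?s)"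
    by (intro mult_left_mono) auto
  moreover have "flux p \<bullet> (q - p) = a * (p \<bullet> q) - a * ?r\<^sup>2"
    by (simp add: flux_def a_def inner_diff_right power2_norm_eq_inner algebra_simps)
  moreover have "(norm (q - p))\<^sup>2 = ?s\<^sup>2 + ?r\<^sup>2 - 2 * (p \<bullet> q)"
    by (simp add: power2_norm_diff inner_commute)
  moreover have "?r / (1 + ?r\<^sup>2) * (?s - ?r) = a * (?r * ?s) - a * ?r\<^sup>2"
    by (simp add: a_def divide_inverse algebra_simps power2_eq_square)
  moreover have "(?s - ?r)\<^sup>2 = ?s\<^sup>2 + ?r\<^sup>2 - 2 * (?r * ?s)"
    by (simp add: power2_diff)
  ultimately show ?thesis
    using ln_1_plus_sq_above_tangent_real[of ?s ?r] by (simp add: algebra_simps)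
qed

lemma two_inner_le: "2 * \<bar>x \<bullet> y\<bar> \<le> (norm x)\<^sup>2 + (norm y)\<^sup>2"
  using Cauchy_Schwarz_ineq2[of x y] sum_squares_bound[of "norm x" "norm y"] by simp

lemma explicit_flux_bound:
  fixes p0 p1 p2 q :: "'a::real_inner"
  shows "- ((3 *\<^sub>R flux p0 - 3 *\<^sub>R flux p1 + flux p2) \<bullet> (q - p0))
    \<ge> - (1 / 2) * ln (1 + (norm q)\<^sup>2) - (- (1 / 2) * ln (1 + (norm p0)\<^sup>2))
      + (3 / 2 * (norm (q - p0))\<^sup>2 + 1 / 2 * (norm (p0 - p1))\<^sup>2)
      - (3 / 2 * (norm (p0 - p1))\<^sup>2 + 1 / 2 * (norm (p1 - p2))\<^sup>2)
      - 49 / 16 * (norm (q - p0))\<^sup>2"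
proof -
  have *: "2 * \<bar>(flux x - flux y) \<bullet> (q - p0)\<bar> \<le> (norm (x - y))\<^sup>2 + (norm (q - p0))\<^sup>2" for x y
    using two_inner_le[of "flux x - flux y" "q - p0"]
      power_mono[OF flux_lipschitz[of x y] norm_ge_zero, of 2] by linarith
  \<comment> \<open>The extrapolation is \<open>flux p0\<close> plus differences that the Lipschitz
    bound controls. The three parts cost \<open>1/16 + 1 + 1/2\<close> times
    \<open>|q - p0|^2\<close>; the telescoping term adds \<open>3/2\<close>, which gives
    \<open>49/16\<close>. Of the weight \<open>3/2\<close> on \<open>|p0 - p1|^2\<close>,
    \<open>1\<close> pays the present step and \<open>1/2\<close> is kept for the next.\<close>
  have "(3 *\<^sub>R flux p0 - 3 *\<^sub>R flux p1 + flux p2) \<bullet> (q - p0)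
      = flux p0 \<bullet> (q - p0) + 2 * ((flux p0 - flux p1) \<bullet> (q - p0)) - (flux p1 - flux p2) \<bullet> (q - p0)"
    by (simp add: inner_add_left inner_diff_left)
  then show ?thesis
    using ln_1_plus_norm_sq_above_tangent[of q p0] *[of p0 p1] *[of p1 p2] by linarith
qed

section \<open>Scalar inequalities for the time difference and the stabilisation\<close>

text \<open>In the increments \<open>a = v - u0\<close>, \<open>b = u0 - u1\<close>,
  \<open>c = u1 - u2\<close> the first factor is \<open>11/6 a - 7/6 b + 1/3 c\<close>. Completing
  squares in \<open>a b\<close> and \<open>a c\<close> leaves the squares of \<open>a - b\<close>
  and \<open>a + c\<close>, which are dropped.\<close>

lemma bdf3_telescope:
  fixes v u0 u1 u2 :: real
  shows "(11 / 6 * v - 3 * u0 + 3 / 2 * u1 - 1 / 3 * u2) * (v - u0)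
    \<ge> (3 / 4 * (v - u0)\<^sup>2 + 1 / 6 * (u0 - u1)\<^sup>2) - (3 / 4 * (u0 - u1)\<^sup>2 + 1 / 6 * (u1 - u2)\<^sup>2)
      + 1 / 3 * (v - u0)\<^sup>2"
proof -
  have "(11 / 6 * v - 3 * u0 + 3 / 2 * u1 - 1 / 3 * u2) * (v - u0)
      = (3 / 4 * (v - u0)\<^sup>2 + 1 / 6 * (u0 - u1)\<^sup>2) - (3 / 4 * (u0 - u1)\<^sup>2 + 1 / 6 * (u1 - u2)\<^sup>2)
        + 1 / 3 * (v - u0)\<^sup>2
        + (7 / 12 * (v - u0 - (u0 - u1))\<^sup>2 + 1 / 6 * (v - u0 + (u1 - u2))\<^sup>2)"
    by (simp add: power2_eq_square field_simps)
  then show ?thesis by simp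
qed

lemma quadratic_form_nonneg:
  fixes a b c x y :: real
  assumes "a > 0" "c\<^sup>2 \<le> 4 * a * b"
  shows "0 \<le> a * x\<^sup>2 + b * y\<^sup>2 + c * x * y"
proof -
  have "0 \<le> (2 * a * x + c * y)\<^sup>2 + (4 * a * b - c\<^sup>2) * y\<^sup>2"
    using assms by simp
  also have "\<dots> = 4 * a * (a * x\<^sup>2 + b * y\<^sup>2 + c * x * y)"
    by (simp add: power2_eq_square algebra_simps)
  finally show ?thesis using assms by (simp add: zero_le_mult_iff)
qed

text \<open>The claim amounts to
  \<open>3 c^2 \<Delta>t \<le> 2 \<epsilon>^2 + 4 A \<Delta>t^2\<close>. By the arithmetic-geometric
  mean inequality the square of the right side is at least
  \<open>32 A \<epsilon>^2 \<Delta>t^2\<close>, hence at least \<open>9 c^4 \<Delta>t^2\<close>;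
  both squares carry the same power of \<open>\<Delta>t\<close>, so the threshold for
  \<open>A\<close> is free of it.\<close>

lemma stabilization_discriminant:
  fixes \<epsilon> \<Delta>t A c :: real
  assumes "\<epsilon> > 0" "\<Delta>t > 0" "A \<ge> 9 / 32 * c ^ 4 / \<epsilon>\<^sup>2"
  shows "c\<^sup>2 \<le> 4 * (1 / (3 * \<Delta>t)) * (\<epsilon>\<^sup>2 / 2 + A * \<Delta>t\<^sup>2)"
proof -
  have A: "9 / 32 * c ^ 4 \<le> A * \<epsilon>\<^sup>2"
    using assms by (simp add: divide_le_eq)
  have "A \<ge> 0"
    using assms by (smt (verit) divide_nonneg_pos zero_le_even_power even_numeral zero_less_power mult_nonneg_nonneg)
  have "(3 * c\<^sup>2 * \<Delta>t)\<^sup>2 = 32 * (9 / 32 * c ^ 4) * \<Delta>t\<^sup>2"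
    by (simp add: power2_eq_square power4_eq_xxxx)
  also have "\<dots> \<le> 32 * (A * \<epsilon>\<^sup>2) * \<Delta>t\<^sup>2"
    using A by (intro mult_right_mono) auto
  also have "\<dots> \<le> (2 * \<epsilon>\<^sup>2 + 4 * A * \<Delta>t\<^sup>2)\<^sup>2"
    using zero_le_power2[of "2 * \<epsilon>\<^sup>2 - 4 * A * \<Delta>t\<^sup>2"]
    by (simp add: power2_eq_square algebra_simps)
  finally have "3 * c\<^sup>2 * \<Delta>t \<le> 2 * \<epsilon>\<^sup>2 + 4 * A * \<Delta>t\<^sup>2"
    by (rule power2_le_imp_le) (use \<open>A \<ge> 0\<close> in simp)
  then show ?thesis using assms by (simp add: field_simps)
qed

section \<open>Decay of the modified energy\<close>

text \<open>The energy density plus history terms, with the weights of \<open>bdf3_telescope\<close>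
  and \<open>explicit_flux_bound\<close>. At the starting values its mean is the bound to be
  proved.\<close>

definition modified_density ::
  "nat \<Rightarrow> real \<Rightarrow> real \<Rightarrow> real grid_fun \<Rightarrow> real grid_fun \<Rightarrow> real grid_fun \<Rightarrow> real grid_fun" where
  "modified_density K \<epsilon> \<Delta>t v0 v1 v2 i j =
     - (1 / 2) * ln (1 + (norm (grad_N K v0 i j))\<^sup>2) + \<epsilon>\<^sup>2 / 2 * (lap_N K v0 i j)\<^sup>2
     + 3 / (4 * \<Delta>t) * (v0 i j - v1 i j)\<^sup>2 + 1 / (6 * \<Delta>t) * (v1 i j - v2 i j)\<^sup>2
     + 3 / 2 * (norm (grad_N K v0 i j - grad_N K v1 i j))\<^sup>2
     + 1 / 2 * (norm (grad_N K v1 i j - grad_N K v2 i j))\<^sup>2"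

lemma grid_mean_modified_density:
  "grid_mean K (modified_density K \<epsilon> \<Delta>t v0 v1 v2) =
     energy_N K \<epsilon> v0
     + 3 / (4 * \<Delta>t) * (grid_norm K (\<lambda>i j. v0 i j - v1 i j))\<^sup>2
     + 1 / (6 * \<Delta>t) * (grid_norm K (\<lambda>i j. v1 i j - v2 i j))\<^sup>2
     + 3 / 2 * (grid_norm K (grad_N K (\<lambda>i j. v0 i j - v1 i j)))\<^sup>2
     + 1 / 2 * (grid_norm K (grad_N K (\<lambda>i j. v1 i j - v2 i j)))\<^sup>2"
proof -
  have "energy_c1_N K v0 = grid_mean K (\<lambda>i j. - (1 / 2) * ln (1 + (norm (grad_N K v0 i j))\<^sup>2))"
    by (simp only: energy_c1_N_def grid_mean_def)
  then show ?thesis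
    unfolding modified_density_def[abs_def] energy_N_def grid_norm_sq grad_N_diff
      grid_mean_add grid_mean_cmult
    by simp
qed

text \<open>The right side is the density of the tested scheme after summation by parts, plus two
  \<open>49/16\<close> terms. These need not cancel at a point, but their means do; they trade
  \<open>|grad d|^2\<close> for \<open>- d lap d\<close>, which a quadratic form in \<open>d\<close>
  and \<open>lap d\<close> can absorb.\<close>

lemma modified_density_step:
  fixes K :: nat and \<epsilon> \<Delta>t A :: real and v u0 u1 u2 :: "real grid_fun"
  assumes "\<epsilon> > 0" "\<Delta>t > 0" "A \<ge> 9 / 32 * (49 / 16) ^ 4 / \<epsilon>\<^sup>2"
  defines "F \<equiv> \<lambda>i j. 3 *\<^sub>R slope_flux K u0 i j - 3 *\<^sub>R slope_flux K u1 i j + slope_flux K u2 i j"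
    and "d \<equiv> \<lambda>i j. v i j - u0 i j"
  shows "modified_density K \<epsilon> \<Delta>t v u0 u1 i j - modified_density K \<epsilon> \<Delta>t u0 u1 u2 i j
    \<le> 1 / \<Delta>t * ((11 / 6 * v i j - 3 * u0 i j + 3 / 2 * u1 i j - 1 / 3 * u2 i j) * d i j)
      + \<epsilon>\<^sup>2 * (lap_N K v i j * lap_N K d i j) - F i j \<bullet> grad_N K d i j
      + A * \<Delta>t\<^sup>2 * (lap_N K d i j * lap_N K d i j)
      + 49 / 16 * (norm (grad_N K d i j))\<^sup>2 + 49 / 16 * (d i j * lap_N K d i j)"
proof -
  let ?x = "d i j" and ?y = "lap_N K d i j"
  let ?q = "grad_N K v i j" and ?p0 = "grad_N K u0 i j"
  let ?p1 = "grad_N K u1 i j" and ?p2 = "grad_N K u2 i j"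
  \<comment> \<open>The coefficients are what remains of the time difference, the biharmonic term
    and the stabilisation.\<close>
  have quad: "0 \<le> 1 / (3 * \<Delta>t) * ?x\<^sup>2 + (\<epsilon>\<^sup>2 / 2 + A * \<Delta>t\<^sup>2) * ?y\<^sup>2 + 49 / 16 * ?x * ?y"
    using assms(1-3) by (intro quadratic_form_nonneg stabilization_discriminant) auto
  have grad: "grad_N K d i j = ?q - ?p0" and lap: "?y = lap_N K v i j - lap_N K u0 i j"
    by (simp_all add: d_def grad_N_diff lap_N_diff)
  have flux: "slope_flux K f i j = flux (grad_N K f i j)" for f
    by (simp add: slope_flux_def flux_def)
  let ?B = "11 / 6 * v i j - 3 * u0 i j + 3 / 2 * u1 i j - 1 / 3 * u2 i j"
  have "1 / \<Delta>t * ((3 / 4 * ?x\<^sup>2 + 1 / 6 * (u0 i j - u1 i j)\<^sup>2)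
        - (3 / 4 * (u0 i j - u1 i j)\<^sup>2 + 1 / 6 * (u1 i j - u2 i j)\<^sup>2) + 1 / 3 * ?x\<^sup>2)
      \<le> 1 / \<Delta>t * (?B * ?x)"
    using assms(2) unfolding d_def by (intro mult_left_mono bdf3_telescope) auto
  then have bdf: "3 / (4 * \<Delta>t) * ?x\<^sup>2 + 1 / (6 * \<Delta>t) * (u0 i j - u1 i j)\<^sup>2
      - 3 / (4 * \<Delta>t) * (u0 i j - u1 i j)\<^sup>2 - 1 / (6 * \<Delta>t) * (u1 i j - u2 i j)\<^sup>2
      + 1 / (3 * \<Delta>t) * ?x\<^sup>2 \<le> 1 / \<Delta>t * (?B * ?x)"
    by (simp add: algebra_simps add_divide_distrib diff_divide_distrib)
  \<comment> \<open>Implicit treatment pays off here: \<open>X (X - Y)\<close> is half of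
    \<open>X^2 - Y^2 + (X - Y)^2\<close>, and the last square is a gain.\<close>
  have biharm: "\<epsilon>\<^sup>2 * (lap_N K v i j * ?y)
      = \<epsilon>\<^sup>2 / 2 * (lap_N K v i j)\<^sup>2 - \<epsilon>\<^sup>2 / 2 * (lap_N K u0 i j)\<^sup>2 + \<epsilon>\<^sup>2 / 2 * ?y\<^sup>2"
    unfolding lap by (simp add: power2_eq_square field_simps)
  have x: "v i j - u0 i j = ?x" by (simp add: d_def)
  from quad have "0 \<le> 1 / (3 * \<Delta>t) * ?x\<^sup>2 + \<epsilon>\<^sup>2 / 2 * ?y\<^sup>2 + A * \<Delta>t\<^sup>2 * (?y * ?y)
      + 49 / 16 * (?x * ?y)"
    by (simp add: distrib_right power2_eq_square mult.assoc)
  with bdf biharm explicit_flux_bound[of ?q ?p0 ?p1 ?p2] show ?thesis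
    unfolding modified_density_def F_def flux grad x by linarith
qed

lemma bdf3_tested:
  fixes K :: nat and u0 u1 u2 v :: "real grid_fun"
  assumes "bdf3_step K \<epsilon> \<Delta>t A v u0 u1 u2"
  defines "F \<equiv> \<lambda>i j. 3 *\<^sub>R slope_flux K u0 i j - 3 *\<^sub>R slope_flux K u1 i j + slope_flux K u2 i j"
    and "d \<equiv> \<lambda>i j. v i j - u0 i j"
  shows "grid_mean K (\<lambda>i j.
      1 / \<Delta>t * ((11 / 6 * v i j - 3 * u0 i j + 3 / 2 * u1 i j - 1 / 3 * u2 i j) * d i j)
      + \<epsilon>\<^sup>2 * (lap_N K v i j * lap_N K d i j) - F i j \<bullet> grad_N K d i j
      + A * \<Delta>t\<^sup>2 * (lap_N K d i j * lap_N K d i j)) = 0"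
proof -
  let ?B = "\<lambda>i j. 11 / 6 * v i j - 3 * u0 i j + 3 / 2 * u1 i j - 1 / 3 * u2 i j"
  have "0 = grid_mean K (\<lambda>i j. (?B i j / \<Delta>t + \<epsilon>\<^sup>2 * lap_N K (lap_N K v) i j
      + div_N K F i j + A * \<Delta>t\<^sup>2 * lap_N K (lap_N K d) i j) * d i j)"
    using assms(1) by (simp add: grid_mean_def bdf3_step_def F_def d_def)
  also have "\<dots> = grid_mean K (\<lambda>i j. 1 / \<Delta>t * (?B i j * d i j)
      + \<epsilon>\<^sup>2 * (lap_N K (lap_N K v) i j * d i j) + div_N K F i j * d i j
      + A * \<Delta>t\<^sup>2 * (lap_N K (lap_N K d) i j * d i j))"
    by (simp add: distrib_right mult.assoc)
  also have "\<dots> = 1 / \<Delta>t * grid_mean K (\<lambda>i j. ?B i j * d i j)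
      + \<epsilon>\<^sup>2 * grid_inner K (lap_N K (lap_N K v)) d + grid_inner K (div_N K F) d
      + A * \<Delta>t\<^sup>2 * grid_inner K (lap_N K (lap_N K d)) d"
    by (simp only: grid_mean_add grid_mean_cmult grid_inner_eq_mean inner_real_def)
  also have "\<dots> = 1 / \<Delta>t * grid_mean K (\<lambda>i j. ?B i j * d i j)
      + \<epsilon>\<^sup>2 * grid_inner K (lap_N K v) (lap_N K d) - grid_inner K F (grad_N K d)
      + A * \<Delta>t\<^sup>2 * grid_inner K (lap_N K d) (lap_N K d)"
    by (simp add: lap_N_adjoint div_N_adjoint)
  finally show ?thesis
    by (simp only: grid_mean_add grid_mean_diff grid_mean_cmult grid_inner_eq_mean inner_real_def)
qed

lemma modified_energy_decreasing:
  assumes "\<epsilon> > 0" "\<Delta>t > 0" "A \<ge> 9 / 32 * (49 / 16) ^ 4 / \<epsilon>\<^sup>2"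
    and step: "bdf3_step K \<epsilon> \<Delta>t A v u0 u1 u2"
  shows "grid_mean K (modified_density K \<epsilon> \<Delta>t v u0 u1)
    \<le> grid_mean K (modified_density K \<epsilon> \<Delta>t u0 u1 u2)"
proof -
  let ?d = "\<lambda>i j. v i j - u0 i j"
  have parts: "49 / 16 * grid_mean K (\<lambda>i j. (norm (grad_N K ?d i j))\<^sup>2)
      + 49 / 16 * grid_mean K (\<lambda>i j. ?d i j * lap_N K ?d i j) = 0"
    using grid_norm_grad_N[of K ?d] by (simp add: grid_norm_sq grid_inner_eq_mean)
  have "grid_mean K (\<lambda>i j. modified_density K \<epsilon> \<Delta>t v u0 u1 i j
      - modified_density K \<epsilon> \<Delta>t u0 u1 u2 i j) \<le> 0"
    \<comment> \<open>The mean of the pointwise bound splits into the tested scheme and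
      \<open>parts\<close>, both zero.\<close>
    by (rule order_trans[OF grid_mean_mono[OF modified_density_step[OF assms(1-3)]]])
      (use parts bdf3_tested[OF step] in \<open>simp only: grid_mean_add grid_mean_cmult\<close>)
  then show ?thesis by (simp add: grid_mean_diff)
qed

theorem corollary2p7:
  fixes K :: nat and \<epsilon> \<Delta>t A :: real and u :: "int \<Rightarrow> real grid_fun"
  assumes "K > 0" and "\<epsilon> > 0" and "\<Delta>t > 0"
    and "A \<ge> 9 / 32 * (49 / 16) ^ 4 / \<epsilon>\<^sup>2"
    and "\<forall>n\<ge>-2. periodic_grid K (u n)"
    and "\<forall>n\<ge>0. bdf3_step K \<epsilon> \<Delta>t A (u (n + 1)) (u n) (u (n - 1)) (u (n - 2))"
  shows "\<forall>k\<ge>0. energy_N K \<epsilon> (u k) \<le>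
           energy_N K \<epsilon> (u 0)
           + 3 / (4 * \<Delta>t) * (grid_norm K (\<lambda>i j. u 0 i j - u (-1) i j))\<^sup>2
           + 1 / (6 * \<Delta>t) * (grid_norm K (\<lambda>i j. u (-1) i j - u (-2) i j))\<^sup>2
           + 3 / 2 * (grid_norm K (grad_N K (\<lambda>i j. u 0 i j - u (-1) i j)))\<^sup>2
           + 1 / 2 * (grid_norm K (grad_N K (\<lambda>i j. u (-1) i j - u (-2) i j)))\<^sup>2"
proof (intro allI impI)
  fix k :: int
  let ?M = "\<lambda>n. grid_mean K (modified_density K \<epsilon> \<Delta>t (u n) (u (n - 1)) (u (n - 2)))"
  assume "k \<ge> 0"
  then have "?M k \<le> ?M 0"
  proof (induction k rule: int_ge_induct)
    case (step n)
    have "bdf3_step K \<epsilon> \<Delta>t A (u (n + 1)) (u n) (u (n - 1)) (u (n - 2))"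
      using assms(6) step.hyps by simp
    from modified_energy_decreasing[OF assms(2-4) this]
    have "?M (n + 1) \<le> ?M n" by simp
    then show ?case using step.IH by linarith
  qed simp
  \<comment> \<open>The history terms are nonnegative.\<close>
  moreover have "energy_N K \<epsilon> (u k) \<le> ?M k"
    unfolding grid_mean_modified_density using assms(3) by (simp add: add_nonneg_nonneg add.assoc)
  ultimately have "energy_N K \<epsilon> (u k) \<le> ?M 0" by linarith
  then show "energy_N K \<epsilon> (u k) \<le>
           energy_N K \<epsilon> (u 0)
           + 3 / (4 * \<Delta>t) * (grid_norm K (\<lambda>i j. u 0 i j - u (-1) i j))\<^sup>2
           + 1 / (6 * \<Delta>t) * (grid_norm K (\<lambda>i j. u (-1) i j - u (-2) i j))\<^sup>2
           + 3 / 2 * (grid_norm K (grad_N K (\<lambda>i j. u 0 i j - u (-1) i j)))\<^sup>2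
           + 1 / 2 * (grid_norm K (grad_N K (\<lambda>i j. u (-1) i j - u (-2) i j)))\<^sup>2"
    by (simp only: grid_mean_modified_density diff_0)
qed

end
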